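(* Let $(X,d)$ be a metric space, let $n\ge 1$, let $A_1,A_2,\ldots,A_n\subseteq X$ be compact subsets, and let $\beta:2^{[n]}\to[0,\infty)$ be a fractional partition. Then, for every $t>0$, $$\exp C^t\Big(\bigcup_{i=1}^n A_i\Big)\ \le\ \sum_{s\in 2^{[n]}}\beta(s)\,\exp C^t\Big(\bigcup_{i\in s}A_i\Big).$$ In other words, given any compact subsets $A_1,\ldots,A_n$ of $X$, the set function $f:2^{[n]}\to\mathbb{R}$, $f(s):=1+\kappa^t\big(\bigcup_{i\in s}A_i\big)$, is fractionally subadditive.
   Context: $[n]=\{1,\ldots,n\}$ and $2^{[n]}$ is the collection of all subsets of $[n]$. A function $\beta:2^{[n]}\to[0,\infty)$ is a fractional partition if $\sum_{s\in 2^{[n]}:\, i\in s}\beta(s)=1$ for each $i\in[n]$. A set function $f:2^{[n]}\to\mathbb{R}$ is fractionally subadditive if $f([n])\le\sum_{s\in 2^{[n]}}\beta(s)f(s)$ for all fractional partitions $\beta$. Complexity. Let $(F,\rho)$ be a non-empty finite metric space and $Z(x,y)=e^{-\rho(x,y)}$. For a probability measure $p=(p_x)_{x\in F}$ on $F$ put $(Zp)_x=\sum_{y\in F}Z(x,y)p_y$ and, for $\alpha\in[0,\infty]$, $$H^Z_\alpha(p)=\begin{cases}\frac{1}{1-\alpha}\log\left(\sum_x p_x (Zp)_x^{\alpha-1}\right), & \alpha\in[0,1)\cup(1,\infty),\\ -\sum_x p_x\log (Zp)_x, & \alpha=1,\\ -\log\left(\max_{x:\,p_x>0}(Zp)_x\right),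 & \alpha=\infty.\end{cases}$$ The complexity of $(F,\rho)$ is $\sup_p H^Z_\alpha(p)$, the supremum being over all probability measures $p$ on $F$; by a known theorem of Leinster and Meckes this value does not depend on the choice of $\alpha\in[0,\infty]$. For a metric space $(X,d)$, $t>0$ and a non-empty finite $F\subseteq X$, $C^t(F)$ is the complexity of the metric space $(F,td)$; by convention $C^t(\emptyset)=0$. For compact $K\subseteq X$, $C^t(K)=\sup\{C^t(F): F\subseteq K,\ F \text{ finite}\}$, and $\kappa^t(K)=\exp\{C^t(K)\}-1$. *)

theory Defs
  imports "HOL-Analysis.Analysis"
begin

section \<open>Fractional partitions and fractional subadditivity\<close>

text \<open>Here \<open>[n]\<close> is \<open>{1..n}\<close>. Only the values on \<open>Pow {1..n}\<close> of a function
  \<open>nat set \<Rightarrow> real\<close> matter.\<close>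

definition fractional_partition :: "nat \<Rightarrow> (nat set \<Rightarrow> real) \<Rightarrow> bool" where
  "fractional_partition n \<beta> \<longleftrightarrow>
     (\<forall>s\<in>Pow {1..n}. 0 \<le> \<beta> s) \<and>
     (\<forall>i\<in>{1..n}. (\<Sum>s\<in>{s\<in>Pow {1..n}. i \<in> s}. \<beta> s) = 1)"

definition fractionally_subadditive :: "nat \<Rightarrow> (nat set \<Rightarrow> real) \<Rightarrow> bool" where
  "fractionally_subadditive n f \<longleftrightarrow>
     (\<forall>\<beta>. fractional_partition n \<beta> \<longrightarrow> f {1..n} \<le> (\<Sum>s\<in>Pow {1..n}. \<beta> s * f s))"

section \<open>Diversity of order \<open>\<alpha>\<close> and complexity\<close>

text \<open>A probability measure on a finite set \<open>F\<close> is given by its vector of point masses;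
  values outside \<open>F\<close> are never used.\<close>

definition prob_vectors :: "'a set \<Rightarrow> ('a \<Rightarrow> real) set" where
  "prob_vectors F = {p. (\<forall>x\<in>F. 0 \<le> p x) \<and> (\<Sum>x\<in>F. p x) = 1}"

definition Zmat :: "('a \<Rightarrow> 'a \<Rightarrow> real) \<Rightarrow> 'a \<Rightarrow> 'a \<Rightarrow> real" where
  "Zmat \<rho> x y = exp (- \<rho> x y)"

definition Zapp :: "'a set \<Rightarrow> ('a \<Rightarrow> 'a \<Rightarrow> real) \<Rightarrow> ('a \<Rightarrow> real) \<Rightarrow> 'a \<Rightarrow> real" where
  "Zapp F \<rho> p x = (\<Sum>y\<in>F. Zmat \<rho> x y * p y)"

text \<open>The order \<open>\<alpha>\<close> ranges over \<open>[0,\<infinity>]\<close>, the type \<open>ennreal\<close>.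
  For \<open>\<alpha> < 1\<close> the points with \<open>p x = 0\<close> contribute \<open>0\<close> to the sum.\<close>

definition HZ :: "ennreal \<Rightarrow> 'a set \<Rightarrow> ('a \<Rightarrow> 'a \<Rightarrow> real) \<Rightarrow> ('a \<Rightarrow> real) \<Rightarrow> real" where
  "HZ \<alpha> F \<rho> p =
     (if \<alpha> = \<infinity> then - ln (Max (Zapp F \<rho> p ` {x\<in>F. 0 < p x}))
      else if \<alpha> = 1 then - (\<Sum>x\<in>F. p x * ln (Zapp F \<rho> p x))
      else 1 / (1 - enn2real \<alpha>) * ln (\<Sum>x\<in>F. p x * Zapp F \<rho> p x powr (enn2real \<alpha> - 1)))"

definition complexity :: "ennreal \<Rightarrow> 'a set \<Rightarrow> ('a \<Rightarrow> 'a \<Rightarrow> real) \<Rightarrow> real" where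
  "complexity \<alpha> F \<rho> = (SUP p\<in>prob_vectors F. HZ \<alpha> F \<rho> p)"

definition C_fin :: "ennreal \<Rightarrow> ('a \<Rightarrow> 'a \<Rightarrow> real) \<Rightarrow> real \<Rightarrow> 'a set \<Rightarrow> real" where
  "C_fin \<alpha> d t F = (if F = {} then 0 else complexity \<alpha> F (\<lambda>x y. t * d x y))"

text \<open>The suprema are suprema of reals; the lemmas \<open>bdd_above_HZ\<close> and
  \<open>bdd_above_C_fin\<close> below show that the families involved are bounded. By
  \<open>C_cpt_finite\<close>, \<open>C_cpt\<close> extends \<open>C_fin\<close>. The order \<open>\<alpha>\<close> is kept as a
  parameter: that the complexity is independent of it is a theorem of Leinster and Meckes.\<close>

definition C_cpt :: "ennreal \<Rightarrow> ('a \<Rightarrow> 'a \<Rightarrow> real) \<Rightarrow> real \<Rightarrow> 'a set \<Rightarrow> real" where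
  "C_cpt \<alpha> d t K = (SUP F\<in>{F. F \<subseteq> K \<and> finite F}. C_fin \<alpha> d t F)"

definition kappa :: "ennreal \<Rightarrow> ('a \<Rightarrow> 'a \<Rightarrow> real) \<Rightarrow> real \<Rightarrow> 'a set \<Rightarrow> real" where
  "kappa \<alpha> d t K = exp (C_cpt \<alpha> d t K) - 1"

section \<open>The suprema are finite\<close>

lemma Zapp_pos:
  assumes "finite F" "p \<in> prob_vectors F"
  shows "0 < Zapp F \<rho> p x"
proof -
  have nn: "\<forall>y\<in>F. 0 \<le> p y" and s1: "(\<Sum>y\<in>F. p y) = 1"
    using assms(2) by (auto simp: prob_vectors_def)
  have "\<exists>y\<in>F. p y \<noteq> 0"
    using s1 by (metis sum.neutral zero_neq_one)
  then obtain y where y: "y \<in> F" "0 < p y" using nn by force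
  show ?thesis
    unfolding Zapp_def Zmat_def
    by (rule sum_pos2[OF assms(1) y(1)]) (use y nn in auto)
qed

lemma powr_sum_concave:
  fixes r :: real
  assumes "finite F" "p \<in> prob_vectors F" "\<And>x. x \<in> F \<Longrightarrow> 0 < v x" "r \<noteq> 0" "r \<le> 1"
  shows "1 / r * ln (\<Sum>x\<in>F. p x * v x powr r) \<le> ln (\<Sum>x\<in>F. p x * v x)"
proof -
  have nn: "\<And>y. y \<in> F \<Longrightarrow> 0 \<le> p y" and s1: "(\<Sum>y\<in>F. p y) = 1"
    using assms(2) by (auto simp: prob_vectors_def)
  have "\<exists>y\<in>F. p y \<noteq> 0"
    using s1 by (metis sum.neutral zero_neq_one)
  then obtain y where y: "y \<in> F" "0 < p y" using nn by force
  define S where "S = (\<Sum>x\<in>F. p x * v x)"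
  define T where "T = (\<Sum>x\<in>F. p x * v x powr r)"
  have S: "S > 0" unfolding S_def
    by (rule sum_pos2[OF assms(1) y(1)]) (use y nn assms(3) in \<open>auto simp: less_imp_le\<close>)
  have T: "T > 0" unfolding T_def
    by (rule sum_pos2[OF assms(1) y(1)]) (use y nn assms(3)[OF y(1)] in auto)
  have lin: "(\<Sum>x\<in>F. p x * (1 + r * (v x / S - 1))) = 1"
  proof -
    have "(\<Sum>x\<in>F. p x * (1 + r * (v x / S - 1)))
        = (\<Sum>x\<in>F. (1 - r) * p x + r / S * (p x * v x))"
      by (rule sum.cong) (auto simp: algebra_simps)
    also have "\<dots> = (1 - r) * 1 + r / S * S"
      by (simp only: sum.distrib sum_distrib_left[symmetric] s1 S_def)
    finally show ?thesis using S by simp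
  qed
  have resc: "(\<Sum>x\<in>F. p x * (v x / S) powr r) = T / S powr r"
    unfolding T_def sum_divide_distrib
    using S assms(3) by (intro sum.cong) (auto simp: powr_divide less_imp_le)
  show ?thesis
  proof (cases "r > 0")
    case True
    have "(v x / S) powr r \<le> 1 + r * (v x / S - 1)" if "x \<in> F" for x
    proof -
      have "0 < v x / S" using assms(3)[OF that] S by simp
      then have "(v x / S) powr r * 1 powr (1 - r) \<le> r * (v x / S) + (1 - r) * 1"
        using True assms(5) by (intro Youngs_inequality_0) auto
      then show ?thesis by (simp only: powr_one_eq_one right_diff_distrib mult_1_right)
    qed
    then have "(\<Sum>x\<in>F. p x * (v x / S) powr r) \<le> (\<Sum>x\<in>F. p x * (1 + r * (v x / S - 1)))"
      using nn by (intro sum_mono mult_left_mono) auto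
    then have "T / S powr r \<le> 1" by (simp only: lin resc)
    then have "T \<le> S powr r" using S by (simp add: field_simps)
    then have "ln T \<le> r * ln S" using T S ln_mono[of T "S powr r"] by (simp add: ln_powr)
    then show ?thesis using True
      by (simp add: S_def T_def field_simps)
  next
    case False
    then have r: "r < 0" using assms(4) by simp
    have "1 + r * (v x / S - 1) \<le> (v x / S) powr r" if "x \<in> F" for x
    proof -
      have "0 < v x / S" using assms(3) S that by simp
      then have "ln (v x / S) \<le> v x / S - 1" by (rule ln_le_minus_one)
      then have "r * (v x / S - 1) \<le> r * ln (v x / S)"
        using r by (simp add: mult_le_cancel_left)
      also have "1 + r * ln (v x / S) \<le> exp (r * ln (v x / S))"
        by (rule exp_ge_add_one_self)
      also have "\<dots> = (v x / S) powr r"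
        using assms(3)[OF that] S unfolding powr_def by simp
      finally show ?thesis by simp
    qed
    then have "(\<Sum>x\<in>F. p x * (1 + r * (v x / S - 1))) \<le> (\<Sum>x\<in>F. p x * (v x / S) powr r)"
      using nn by (intro sum_mono mult_left_mono) auto
    then have "1 \<le> T / S powr r" by (simp only: lin resc)
    then have "S powr r \<le> T" using S by (simp add: field_simps)
    then have "r * ln S \<le> ln T" using T S ln_mono[of "S powr r" T] by (simp add: ln_powr)
    then show ?thesis using r
      by (simp add: S_def T_def divide_le_eq mult.commute)
  qed
qed

text \<open>The order \<open>0\<close> dominates all orders.\<close>

lemma HZ_le_order0:
  assumes "finite F" "p \<in> prob_vectors F"
  shows "HZ \<alpha> F \<rho> p \<le> ln (\<Sum>x\<in>F. p x / Zapp F \<rho> p x)"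
proof -
  let ?u = "Zapp F \<rho> p"
  have u: "\<And>x. 0 < ?u x" using Zapp_pos[OF assms] .
  have nn: "\<And>y. y \<in> F \<Longrightarrow> 0 \<le> p y" and s1: "(\<Sum>y\<in>F. p y) = 1"
    using assms(2) by (auto simp: prob_vectors_def)
  have "\<exists>y\<in>F. p y \<noteq> 0"
    using s1 by (metis sum.neutral zero_neq_one)
  then obtain y where y: "y \<in> F" "0 < p y" using nn by force
  define S where "S = (\<Sum>x\<in>F. p x / ?u x)"
  have S: "S > 0" unfolding S_def
    by (rule sum_pos2[OF assms(1) y(1)]) (use y nn u in \<open>auto simp: less_imp_le\<close>)
  consider "\<alpha> = \<infinity>" | "\<alpha> = 1" | "\<alpha> \<noteq> \<infinity>" "\<alpha> \<noteq> 1" by blast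
  then have "HZ \<alpha> F \<rho> p \<le> ln S"
  proof cases
    case 1
    define M where "M = Max (?u ` {x\<in>F. 0 < p x})"
    have le: "?u x \<le> M" if "x \<in> F" "0 < p x" for x
      unfolding M_def using assms(1) that by (intro Max_ge) auto
    have M: "M > 0" using le[OF y] u[of y] by linarith
    have "p x / M \<le> p x / ?u x" if "x \<in> F" for x
    proof (cases "p x = 0")
      case False
      then have "0 < p x" using nn[OF that] by simp
      then show ?thesis using le[OF that] u[of x] by (intro divide_left_mono) auto
    qed simp
    then have "(\<Sum>x\<in>F. p x / M) \<le> S" unfolding S_def by (rule sum_mono)
    then have "1 / M \<le> S" by (simp add: sum_divide_distrib[symmetric] s1)
    then have "ln (1 / M) \<le> ln S" using M S by simp
    then show ?thesis using 1 M by (simp add: HZ_def M_def ln_div)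
  next
    case 2
    have "- ln (?u x) - ln S \<le> 1 / ?u x / S - 1" for x
    proof -
      have "ln (1 / ?u x / S) \<le> 1 / ?u x / S - 1"
        using u[of x] S by (intro ln_le_minus_one) simp
      moreover have "ln (1 / ?u x / S) = - ln (?u x) - ln S"
        using u[of x] S by (simp add: ln_div ln_mult)
      ultimately show ?thesis by simp
    qed
    then have "(\<Sum>x\<in>F. p x * (- ln (?u x) - ln S)) \<le> (\<Sum>x\<in>F. p x * (1 / ?u x / S - 1))"
      using nn by (intro sum_mono mult_left_mono) auto
    also have "\<dots> = S / S - 1"
    proof -
      have "(\<Sum>x\<in>F. p x * (1 / ?u x / S - 1)) = (\<Sum>x\<in>F. p x / ?u x / S - p x)"
        by (rule sum.cong) (auto simp: right_diff_distrib)
      also have "\<dots> = (\<Sum>x\<in>F. p x / ?u x) / S - 1"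
        by (simp only: sum_subtractf s1 sum_divide_distrib)
      finally show ?thesis unfolding S_def .
    qed
    finally have "(\<Sum>x\<in>F. p x * (- ln (?u x) - ln S)) \<le> 0" using S by simp
    moreover have "(\<Sum>x\<in>F. p x * (- ln (?u x) - ln S)) = - (\<Sum>x\<in>F. p x * ln (?u x)) - ln S"
      by (simp add: right_diff_distrib sum_subtractf sum_distrib_right[symmetric] s1 sum_negf)
    ultimately show ?thesis using 2 by (simp add: HZ_def)
  next
    case 3
    define r where "r = 1 - enn2real \<alpha>"
    have "enn2real \<alpha> \<noteq> 1"
      using 3 by (metis ennreal_1 ennreal_enn2real infinity_ennreal_def less_top)
    then have r: "r \<noteq> 0" "r \<le> 1" by (auto simp: r_def)
    have eq: "?u x powr (enn2real \<alpha> - 1) = (1 / ?u x) powr r" for x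
      using u[of x] by (simp add: r_def powr_def ln_div algebra_simps)
    have "1 / r * ln (\<Sum>x\<in>F. p x * (1 / ?u x) powr r) \<le> ln (\<Sum>x\<in>F. p x * (1 / ?u x))"
      by (rule powr_sum_concave[OF assms]) (use u r in auto)
    then show ?thesis using 3 by (simp add: HZ_def eq r_def S_def)
  qed
  then show ?thesis by (simp add: S_def)
qed

lemma HZ_le_cover:
  assumes F: "finite F" "p \<in> prob_vectors F" and I: "finite I" "c ` F \<subseteq> I"
    and D: "\<And>x y. \<lbrakk>x \<in> F; y \<in> F; c x = c y\<rbrakk> \<Longrightarrow> \<rho> x y \<le> D"
  shows "HZ \<alpha> F \<rho> p \<le> ln (real (card I) * exp D)"
proof -
  let ?u = "Zapp F \<rho> p"
  have u: "\<And>x. 0 < ?u x" using Zapp_pos[OF F] .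
  have nn: "\<And>y. y \<in> F \<Longrightarrow> 0 \<le> p y" and s1: "(\<Sum>y\<in>F. p y) = 1"
    using F(2) by (auto simp: prob_vectors_def)
  have "\<exists>y\<in>F. p y \<noteq> 0"
    using s1 by (metis sum.neutral zero_neq_one)
  then obtain y where y: "y \<in> F" "0 < p y" using nn by force
  define P where "P i = (\<Sum>y\<in>{y\<in>F. c y = i}. p y)" for i
  have lower: "exp (- D) * P (c x) \<le> ?u x" if "x \<in> F" for x
  proof -
    have "exp (- D) * P (c x) = (\<Sum>y\<in>{y\<in>F. c y = c x}. exp (- D) * p y)"
      by (simp add: P_def sum_distrib_left)
    also have "\<dots> \<le> (\<Sum>y\<in>{y\<in>F. c y = c x}. Zmat \<rho> x y * p y)"
      using D[OF that] nn by (intro sum_mono mult_right_mono) (auto simp: Zmat_def)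
    also have "\<dots> \<le> ?u x"
      unfolding Zapp_def using F(1) nn by (intro sum_mono2) (auto simp: Zmat_def)
    finally show ?thesis .
  qed
  have summand: "p x / ?u x \<le> exp D * (p x / P (c x))" if "x \<in> F" for x
  proof (cases "p x = 0")
    case False
    then have px: "0 < p x" using nn[OF that] by simp
    have "p x \<le> P (c x)"
      unfolding P_def using F(1) that nn by (intro member_le_sum) auto
    then have "P (c x) > 0" using px by linarith
    then have "p x / ?u x \<le> p x / (exp (- D) * P (c x))"
      using lower[OF that] px u[of x] by (intro divide_left_mono) auto
    also have "\<dots> = exp D * (p x / P (c x))" by (simp add: exp_minus field_simps)
    finally show ?thesis .
  qed simp
  have "(\<Sum>x\<in>F. p x / ?u x) \<le> (\<Sum>x\<in>F. exp D * (p x / P (c x)))"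
    using summand by (rule sum_mono)
  also have "\<dots> = (\<Sum>i\<in>I. \<Sum>x\<in>{x\<in>F. c x = i}. exp D * (p x / P (c x)))"
    by (rule sum.group[symmetric]) (use F I in auto)
  also have "\<dots> = (\<Sum>i\<in>I. exp D * (P i / P i))"
  proof (rule sum.cong[OF refl])
    fix i
    have "(\<Sum>x\<in>{x\<in>F. c x = i}. exp D * (p x / P (c x)))
        = (\<Sum>x\<in>{x\<in>F. c x = i}. exp D * (p x / P i))"
      by (rule sum.cong) auto
    also have "\<dots> = exp D * ((\<Sum>x\<in>{x\<in>F. c x = i}. p x) / P i)"
      by (simp only: sum_distrib_left sum_divide_distrib)
    finally show "(\<Sum>x\<in>{x\<in>F. c x = i}. exp D * (p x / P (c x))) = exp D * (P i / P i)"
      by (simp only: P_def)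
  qed
  also have "\<dots> \<le> (\<Sum>i\<in>I. exp D)"
    by (rule sum_mono) simp
  finally have le: "(\<Sum>x\<in>F. p x / ?u x) \<le> real (card I) * exp D" by simp
  have "0 < (\<Sum>x\<in>F. p x / ?u x)"
    by (rule sum_pos2[OF F(1) y(1)]) (use y nn u in \<open>auto simp: less_imp_le\<close>)
  then have "ln (\<Sum>x\<in>F. p x / ?u x) \<le> ln (real (card I) * exp D)"
    using le by (intro ln_mono) auto
  then show ?thesis using HZ_le_order0[OF F, of \<alpha> \<rho>] by linarith
qed

lemma prob_vectors_nonempty:
  assumes "finite F" "F \<noteq> {}"
  shows "prob_vectors F \<noteq> {}"
proof -
  have "(\<lambda>x. 1 / real (card F)) \<in> prob_vectors F"
    using assms by (simp add: prob_vectors_def)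
  then show ?thesis by blast
qed

lemma bdd_above_HZ:
  assumes "finite F" "\<And>x. x \<in> F \<Longrightarrow> \<rho> x x = 0"
  shows "bdd_above (HZ \<alpha> F \<rho> ` prob_vectors F)"
  using HZ_le_cover[OF assms(1) _ assms(1), where c = id and D = 0 and \<rho> = \<rho> and \<alpha> = \<alpha>] assms(2)
  by (intro bdd_aboveI2) auto

context Metric_space
begin

text \<open>On finite sets the two definitions of the complexity agree.\<close>

lemma C_fin_singleton:
  assumes "x \<in> M"
  shows "C_fin \<alpha> d t {x} = 0"
proof -
  have "HZ \<alpha> {x} (\<lambda>x y. t * d x y) p = 0" if "p \<in> prob_vectors {x}" for p
  proof -
    have px: "p x = 1" using that by (simp add: prob_vectors_def)
    then have u: "Zapp {x} (\<lambda>x y. t * d x y) p x = 1"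
      using assms by (simp add: Zapp_def Zmat_def)
    have "{y \<in> {x}. 0 < p y} = {x}" using px by auto
    then show ?thesis by (simp add: HZ_def px u)
  qed
  then have "complexity \<alpha> {x} (\<lambda>x y. t * d x y) = (SUP p\<in>prob_vectors {x}. 0)"
    unfolding complexity_def by (intro SUP_cong) auto
  then show ?thesis using prob_vectors_nonempty[of "{x}"] by (simp add: C_fin_def)
qed

lemma C_fin_mono:
  assumes "F \<subseteq> G" "finite G" "G \<subseteq> M"
  shows "C_fin \<alpha> d t F \<le> C_fin \<alpha> d t G"
proof -
  let ?\<rho> = "\<lambda>x y. t * d x y"
  have mono: "C_fin \<alpha> d t F' \<le> C_fin \<alpha> d t G" if F': "F' \<subseteq> G" "F' \<noteq> {}" for F'
  proof -
    have "HZ \<alpha> F' ?\<rho> p \<le> complexity \<alpha> G ?\<rho>" if p: "p \<in> prob_vectors F'" for p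
    proof -
      define q where "q x = (if x \<in> F' then p x else 0)" for x
      have sums: "(\<Sum>x\<in>G. q x * g x) = (\<Sum>x\<in>F'. p x * g x)" for g :: "'a \<Rightarrow> real"
        using F'(1) assms(2) by (intro sum.mono_neutral_cong_right) (auto simp: q_def)
      have q: "q \<in> prob_vectors G"
        using p sums[of "\<lambda>_. 1"] by (auto simp: prob_vectors_def q_def)
      have u: "Zapp G ?\<rho> q = Zapp F' ?\<rho> p"
        unfolding Zapp_def mult.commute[of "Zmat _ _ _"] sums ..
      have supp: "{x\<in>G. 0 < q x} = {x\<in>F'. 0 < p x}"
        using F'(1) by (auto simp: q_def)
      have "HZ \<alpha> F' ?\<rho> p = HZ \<alpha> G ?\<rho> q"
        unfolding HZ_def u supp sums ..
      also have "\<dots> \<le> complexity \<alpha> G ?\<rho>"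
        unfolding complexity_def using q assms(2,3)
        by (intro cSUP_upper bdd_above_HZ) auto
      finally show ?thesis .
    qed
    moreover have "finite F'" using F'(1) assms(2) finite_subset by blast
    ultimately have "complexity \<alpha> F' ?\<rho> \<le> complexity \<alpha> G ?\<rho>"
      unfolding complexity_def[of \<alpha> F'] using F' prob_vectors_nonempty
      by (intro cSUP_least) auto
    then show ?thesis using F' by (auto simp: C_fin_def)
  qed
  show ?thesis
  proof (cases "F = {}")
    case True
    have "0 \<le> C_fin \<alpha> d t G"
    proof (cases "G = {}")
      case False
      then obtain x where "x \<in> G" by blast
      then show ?thesis using mono[of "{x}"] C_fin_singleton[of x] assms(3) by auto
    qed (simp add: C_fin_def)
    then show ?thesis using True by (simp add: C_fin_def)
  qed (use mono assms(1) in auto)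
qed

lemma C_cpt_finite:
  assumes "finite K" "K \<subseteq> M"
  shows "C_cpt \<alpha> d t K = C_fin \<alpha> d t K"
  unfolding C_cpt_def
proof (rule cSup_eq_maximum)
  show "C_fin \<alpha> d t K \<in> C_fin \<alpha> d t ` {F. F \<subseteq> K \<and> finite F}" using assms(1) by auto
qed (use assms C_fin_mono in auto)

text \<open>On compact sets the supremum is finite.\<close>

lemma bdd_above_C_fin:
  assumes K: "compactin mtopology K" and t: "0 < t"
  shows "bdd_above (C_fin \<alpha> d t ` {F. F \<subseteq> K \<and> finite F})"
proof -
  have KM: "K \<subseteq> M" using compactin_subset_topspace[OF K] by simp
  have "mtotally_bounded K" using K compactin_imp_mtotally_bounded by blast
  then obtain I where I: "finite I" "I \<subseteq> K" "K \<subseteq> (\<Union>x\<in>I. mball x 1)"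
    unfolding mtotally_bounded_def by (meson zero_less_one)
  then have "\<forall>x\<in>K. \<exists>i. i \<in> I \<and> x \<in> mball i 1" by blast
  then obtain c where c: "\<And>x. x \<in> K \<Longrightarrow> c x \<in> I \<and> x \<in> mball (c x) 1" by metis
  define B where "B = max 0 (ln (real (card I) * exp (t * 2)))"
  have "C_fin \<alpha> d t F \<le> B" if "F \<subseteq> K" "finite F" for F
  proof (cases "F = {}")
    case False
    have diam: "t * d x y \<le> t * 2" if "x \<in> F" "y \<in> F" "c x = c y" for x y
    proof -
      have "x \<in> K" "y \<in> K" using that \<open>F \<subseteq> K\<close> by auto
      then have "x \<in> mball (c x) 1" "y \<in> mball (c x) 1" using c[of x] c[of y] that(3) by simp_all
      then have "d x y \<le> d x (c x) + d (c x) y" "d (c x) x < 1" "d (c x) y < 1"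
        by (auto intro!: triangle)
      then have "d x y \<le> 2" using commute[of x "c x"] by linarith
      then show ?thesis using t by simp
    qed
    have "HZ \<alpha> F (\<lambda>x y. t * d x y) p \<le> ln (real (card I) * exp (t * 2))"
      if "p \<in> prob_vectors F" for p
      by (rule HZ_le_cover[OF \<open>finite F\<close> that I(1), where c = c])
        (use c \<open>F \<subseteq> K\<close> diam in auto)
    then have "complexity \<alpha> F (\<lambda>x y. t * d x y) \<le> ln (real (card I) * exp (t * 2))"
      unfolding complexity_def
      using prob_vectors_nonempty[OF \<open>finite F\<close> False] by (intro cSUP_least) auto
    then show ?thesis using False by (simp add: C_fin_def B_def)
  qed (simp add: C_fin_def B_def)
  then show ?thesis by (intro bdd_aboveI2[where M = B]) auto
qed

end

end

theory Submission
  imports Defs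
begin

text \<open>The function \<open>p \<mapsto> \<Sum>\<^sub>x p\<^sub>x / (Zp)\<^sub>x\<close>, the exponential of the entropy of
  order \<open>0\<close>, is continuous on the simplex because \<open>Z > 0\<close>, so it has a maximiser \<open>p\<close>. It is
  homogeneous of degree \<open>0\<close>; moving \<open>p\<close> towards a point mass at \<open>y\<close> therefore gives
  \<open>u\<^sub>y \<le> \<Sum>\<^sub>x Z\<^sub>x\<^sub>y p\<^sub>x u\<^sub>x\<^sup>2\<close> for \<open>u = 1 / Zp\<close>. At a point of the support where
  \<open>u\<close> is largest, the right side is at most \<open>u\<^sub>y\<close>, with equality only if \<open>u\<close> is constant on the
  support. Hence all orders agree at \<open>p\<close>, and as order \<open>0\<close> dominates the others, the complexity
  does not depend on \<open>\<alpha>\<close>. Rescaling \<open>p\<close> gives a weight \<open>w \<ge> 0\<close> with \<open>Zw = 1\<close> on its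
  support and total mass \<open>exp C\<close>.

  Restricting \<open>w\<close> to a subset can only decrease \<open>Zw\<close>, so the mass of \<open>w\<close> on each subset is at
  most the exponential of the complexity of that subset. As the mass itself is additive, fractional
  subadditivity follows.\<close>

section \<open>Existence of a maximiser of order 0\<close>

lemma order0_maximiser_exists:
  fixes \<rho> :: "'a \<Rightarrow> 'a \<Rightarrow> real"
  assumes "finite F" "F \<noteq> {}"
  obtains p where "p \<in> prob_vectors F"
    "\<And>q. q \<in> prob_vectors F \<Longrightarrow>
       (\<Sum>x\<in>F. q x / Zapp F \<rho> q x) \<le> (\<Sum>x\<in>F. p x / Zapp F \<rho> p x)"
proof -
  \<comment> \<open>\<open>prob_vectors F\<close> leaves values outside \<open>F\<close> free, so it
    need not be compact. Pinning them to 0 gives a product of compact factors and does not change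
    the objective, whose sums run over \<open>F\<close>.\<close>
  define B :: "('a \<Rightarrow> real) set" where "B = PiE UNIV (\<lambda>x. if x \<in> F then {0..1} else {0})"
  define S where "S = B \<inter> {p. (\<Sum>x\<in>F. p x) = 1}"
  let ?f = "\<lambda>p. \<Sum>x\<in>F. p x / Zapp F \<rho> p x"
  have coord: "continuous_on T (\<lambda>p. p x)" for T :: "('a \<Rightarrow> real) set" and x
    by (rule continuous_on_product_coordinates[THEN continuous_on_subset]) simp
  have "compactin (product_topology (\<lambda>_. euclideanreal) UNIV) B"
    unfolding B_def compactin_PiE by (auto simp: compactin_euclidean_iff)
  then have "compact B"
    by (simp add: euclidean_product_topology compactin_euclidean_iff)
  moreover have "closed {p :: 'a \<Rightarrow> real. (\<Sum>x\<in>F. p x) = 1}"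
    by (intro closed_Collect_eq continuous_on_sum coord continuous_on_const)
  ultimately have S: "compact S" unfolding S_def by (rule compact_Int_closed)
  have S_prob: "p \<in> prob_vectors F" if "p \<in> S" for p
  proof -
    have "0 \<le> p x" if "x \<in> F" for x
      using PiE_mem[of p UNIV "\<lambda>x. if x \<in> F then {0..1} else {0}" x] \<open>p \<in> S\<close> that
      by (simp add: S_def B_def)
    then show ?thesis using that by (simp add: S_def prob_vectors_def)
  qed
  have prob_S: "(\<lambda>x. if x \<in> F then q x else 0) \<in> S" if q: "q \<in> prob_vectors F" for q
  proof -
    have "q x \<le> 1" if "x \<in> F" for x
      using member_le_sum[of x F q] q that assms(1) by (auto simp: prob_vectors_def)
    then show ?thesis using q by (auto simp: S_def B_def prob_vectors_def)
  qed
  have "S \<noteq> {}" using prob_S prob_vectors_nonempty[OF assms] by blast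
  moreover have "continuous_on S ?f"
  proof (intro continuous_on_sum continuous_on_divide coord)
    show "continuous_on S (\<lambda>p. Zapp F \<rho> p x)" for x
      unfolding Zapp_def by (intro continuous_intros coord)
    show "\<forall>p\<in>S. Zapp F \<rho> p x \<noteq> 0" for x
      using Zapp_pos[OF assms(1) S_prob, THEN less_imp_neq, THEN not_sym] by blast
  qed
  ultimately obtain p where p: "p \<in> S" "\<And>q. q \<in> S \<Longrightarrow> ?f q \<le> ?f p"
    using continuous_attains_sup[OF S] by blast
  show ?thesis
  proof
    show "?f q \<le> ?f p" if "q \<in> prob_vectors F" for q
    proof -
      have "?f (\<lambda>x. if x \<in> F then q x else 0) = ?f q"
        unfolding Zapp_def by (intro sum.cong refl arg_cong2[of _ _ _ _ "(/)"]) auto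
      then show ?thesis using p(2)[OF prob_S[OF that]] by simp
    qed
  qed (use S_prob p in blast)
qed

section \<open>First-order condition at a maximiser\<close>

text \<open>Allows the objective to be evaluated at unnormalised vectors, so perturbing
  \<open>p\<close> needs no correction of its total mass.\<close>

lemma order0_scale:
  assumes "c \<noteq> 0"
  shows "(\<Sum>x\<in>F. (c * p x) / Zapp F \<rho> (\<lambda>y. c * p y) x) = (\<Sum>x\<in>F. p x / Zapp F \<rho> p x)"
proof -
  have "Zapp F \<rho> (\<lambda>y. c * p y) x = c * Zapp F \<rho> p x" for x
    by (simp add: Zapp_def sum_distrib_left mult.left_commute)
  then show ?thesis using assms by simp
qed

lemma normalise_prob_vectors:
  assumes "\<And>x. x \<in> F \<Longrightarrow> 0 \<le> q x" "0 < sum q F"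
  shows "(\<lambda>x. inverse (sum q F) * q x) \<in> prob_vectors F"
  unfolding prob_vectors_def mem_Collect_eq sum_distrib_left[symmetric]
  using assms by (auto intro!: mult_nonneg_nonneg)

text \<open>Adding mass \<open>h\<close> at \<open>y\<close> creates a new term of order
  \<open>h\<close> and lowers the old terms by at most \<open>h * S\<close>. Optimality forbids a
  net gain; dividing by \<open>h\<close> and letting \<open>h\<close> tend to 0 gives the claim
  without differentiating.\<close>

lemma order0_maximiser_first_order:
  assumes F: "finite F" and p: "p \<in> prob_vectors F"
    and opt: "\<And>q. q \<in> prob_vectors F \<Longrightarrow>
       (\<Sum>x\<in>F. q x / Zapp F \<rho> q x) \<le> (\<Sum>x\<in>F. p x / Zapp F \<rho> p x)"
    and y: "y \<in> F"
  shows "1 / Zapp F \<rho> p y \<le> (\<Sum>x\<in>F. p x * Zmat \<rho> x y / (Zapp F \<rho> p x)\<^sup>2)"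
proof -
  let ?u = "Zapp F \<rho> p" and ?z = "\<lambda>x. Zmat \<rho> x y"
  define S where "S = (\<Sum>x\<in>F. p x * ?z x / (?u x)\<^sup>2)"
  have u: "0 < ?u x" for x using Zapp_pos[OF F p] .
  have z: "0 < ?z x" for x by (simp add: Zmat_def)
  have nn: "\<And>x. x \<in> F \<Longrightarrow> 0 \<le> p x" and s1: "sum p F = 1"
    using p by (auto simp: prob_vectors_def)
  have S0: "0 \<le> S" unfolding S_def
    using nn z by (intro sum_nonneg divide_nonneg_nonneg mult_nonneg_nonneg) (auto simp: less_imp_le)
  have step: "1 \<le> S * (?u y + h * ?z y)" if h: "0 < h" for h
  proof -
    define q where "q x = p x + h * of_bool (x = y)" for x
    have delta: "(\<Sum>x\<in>F. g x * of_bool (x = y)) = g y" for g :: "'a \<Rightarrow> real"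
      using F y by simp
    have Zq: "Zapp F \<rho> q x = ?u x + h * Zmat \<rho> x y" for x
      using delta[of "\<lambda>v. Zmat \<rho> x v * h"]
      unfolding Zapp_def q_def distrib_left sum.distrib mult.assoc by (simp only: mult.commute[of h])
    have sq: "sum q F = 1 + h"
      using delta[of "\<lambda>_. h"] by (simp add: q_def sum.distrib s1)
    have qnn: "0 \<le> q x" if "x \<in> F" for x using nn[OF that] h by (simp add: q_def)
    have "(\<Sum>x\<in>F. q x / Zapp F \<rho> q x) \<le> (\<Sum>x\<in>F. p x / ?u x)"
      using opt[OF normalise_prob_vectors[of F q]] qnn sq h
        order0_scale[where c = "inverse (sum q F)" and F = F and p = q and \<rho> = \<rho>] by simp
    moreover have "(\<Sum>x\<in>F. q x / Zapp F \<rho> q x)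
        = (\<Sum>x\<in>F. p x / (?u x + h * ?z x)) + h / (?u y + h * ?z y)"
      using delta[of "\<lambda>x. h / (?u x + h * ?z x)"]
      by (simp add: Zq q_def add_divide_distrib sum.distrib)
    moreover have "(\<Sum>x\<in>F. p x / ?u x) - h * S \<le> (\<Sum>x\<in>F. p x / (?u x + h * ?z x))"
    proof -
      have "p x / ?u x - h * (p x * ?z x / (?u x)\<^sup>2) \<le> p x / (?u x + h * ?z x)" if "x \<in> F" for x
      proof -
        have "0 < h * ?z x" using h z by simp
        \<comment> \<open>Tangent-line bound 1/(a+b) >= 1/a - b/a^2, valid for every step
          size.\<close>
        have "(?u x - h * ?z x) * (?u x + h * ?z x) \<le> (?u x)\<^sup>2"
          using zero_le_square[of "h * ?z x"] by (simp add: algebra_simps power2_eq_square)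
        then have "(?u x - h * ?z x) / (?u x)\<^sup>2 \<le> 1 / (?u x + h * ?z x)"
          using u[of x] \<open>0 < h * ?z x\<close> by (simp add: divide_simps)
        then have "p x * ((?u x - h * ?z x) / (?u x)\<^sup>2) \<le> p x * (1 / (?u x + h * ?z x))"
          using nn[OF that] by (rule mult_left_mono)
        then show ?thesis
          using u[of x] by (simp add: diff_divide_distrib right_diff_distrib power2_eq_square mult_ac)
      qed
      then have "(\<Sum>x\<in>F. p x / ?u x - h * (p x * ?z x / (?u x)\<^sup>2))
          \<le> (\<Sum>x\<in>F. p x / (?u x + h * ?z x))"
        by (rule sum_mono)
      then show ?thesis by (simp add: S_def sum_subtractf sum_distrib_left)
    qed
    ultimately have "h / (?u y + h * ?z y) \<le> h * S" by linarith
    moreover have "0 < ?u y + h * ?z y" using u[of y] z[of y] h by (simp add: add_pos_pos)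
    ultimately show ?thesis using h by (simp add: divide_le_eq mult.assoc)
  qed
  \<comment> \<open>The limit removes the effect of the added mass on its own denominator.\<close>
  have "((\<lambda>h. S * (?u y + h * ?z y)) \<longlongrightarrow> S * (?u y + 0 * ?z y)) (at_right 0)"
    by (intro tendsto_intros)
  then have "1 \<le> S * (?u y + 0 * ?z y)"
    by (rule tendsto_lowerbound) (auto simp: eventually_at_right_less step intro: eventually_at_rightI[of 0 1])
  then show ?thesis using u[of y] by (simp add: S_def divide_le_eq)
qed

lemma order0_maximiser_balanced:
  assumes F: "finite F" and sym: "\<And>x y. \<lbrakk>x \<in> F; y \<in> F\<rbrakk> \<Longrightarrow> \<rho> x y = \<rho> y x"
    and p: "p \<in> prob_vectors F"
    and opt: "\<And>q. q \<in> prob_vectors F \<Longrightarrow>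
       (\<Sum>x\<in>F. q x / Zapp F \<rho> q x) \<le> (\<Sum>x\<in>F. p x / Zapp F \<rho> p x)"
    and y: "y \<in> F" "0 < p y"
  shows "Zapp F \<rho> p y = 1 / (\<Sum>x\<in>F. p x / Zapp F \<rho> p x)"
proof -
  define u where "u x = 1 / Zapp F \<rho> p x" for x
  have Zpos: "0 < Zapp F \<rho> p x" for x using Zapp_pos[OF F p] .
  then have u: "0 < u x" for x by (simp add: u_def)
  have nn: "\<And>x. x \<in> F \<Longrightarrow> 0 \<le> p x" and s1: "sum p F = 1"
    using p by (auto simp: prob_vectors_def)
  let ?P = "{x\<in>F. 0 < p x}"
  have "Max (u ` ?P) \<in> u ` ?P" using F y by (intro Max_in) auto
  then obtain a where a: "a \<in> F" "0 < p a" "u a = Max (u ` ?P)" by auto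
  have ua: "u x \<le> u a" if "x \<in> F" "0 < p x" for x
    unfolding a(3) using F that by (intro Max_ge) auto
  let ?w = "\<lambda>x. Zmat \<rho> a x * p x"
  have w: "0 \<le> ?w x" if "x \<in> F" for x using nn[OF that] by (simp add: Zmat_def)
  have "u a \<le> (\<Sum>x\<in>F. ?w x * (u x)\<^sup>2)"
    using order0_maximiser_first_order[OF F p opt a(1)] sym[OF a(1)]
    by (simp add: u_def Zmat_def power_divide mult.commute cong: sum.cong)
  \<comment> \<open>The weights \<open>?w\<close> sum to \<open>Zapp F \<rho> p a\<close>, which is
    1 / \<open>u a\<close>.\<close>
  moreover have "u a = (\<Sum>x\<in>F. ?w x * (u a)\<^sup>2)"
    unfolding sum_distrib_right[symmetric] Zapp_def[symmetric]
    using Zpos[of a] by (simp add: u_def power2_eq_square)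
  ultimately have "(\<Sum>x\<in>F. ?w x * ((u a)\<^sup>2 - (u x)\<^sup>2)) \<le> 0"
    by (simp add: right_diff_distrib sum_subtractf)
  moreover have term_nn: "0 \<le> ?w x * ((u a)\<^sup>2 - (u x)\<^sup>2)" if "x \<in> F" for x
  proof (cases "p x = 0")
    case False
    then have "(u x)\<^sup>2 \<le> (u a)\<^sup>2"
      using nn[OF that] ua[OF that] u[of x] by (intro power_mono) auto
    then show ?thesis using w[OF that] by simp
  qed simp
  ultimately have "(\<Sum>x\<in>F. ?w x * ((u a)\<^sup>2 - (u x)\<^sup>2)) = 0"
    by (intro order_antisym sum_nonneg)
  then have zero: "?w x * ((u a)\<^sup>2 - (u x)\<^sup>2) = 0" if "x \<in> F" for x
    using sum_nonneg_eq_0_iff[OF F, of "\<lambda>x. ?w x * ((u a)\<^sup>2 - (u x)\<^sup>2)"] term_nn that by blast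
  have const: "u x = u a" if "x \<in> F" "0 < p x" for x
  proof -
    have "(u a)\<^sup>2 = (u x)\<^sup>2" using zero[OF that(1)] that(2) by (simp add: Zmat_def)
    then show ?thesis using u[of a] u[of x] by (simp add: power2_eq_iff_nonneg less_imp_le)
  qed
  have "(\<Sum>x\<in>F. p x / Zapp F \<rho> p x) = (\<Sum>x\<in>F. p x * u a)"
  proof (rule sum.cong[OF refl])
    fix x assume "x \<in> F"
    then show "p x / Zapp F \<rho> p x = p x * u a"
      using const[of x] nn[of x] by (cases "p x = 0") (auto simp: u_def)
  qed
  also have "\<dots> = u y" using const[OF y] by (simp add: sum_distrib_right[symmetric] s1)
  finally show ?thesis by (simp add: u_def)
qed

section \<open>Independence of the order\<close>

text \<open>The exponential of \<open>HZ\<close> is a \<open>p\<close>-weighted power mean of 1/Zp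
  with exponent 1 - \<alpha> (geometric mean at order 1, minimum at order \<infinity>), and every
  mean of a constant is that constant.\<close>

lemma HZ_balanced:
  assumes "finite F" "p \<in> prob_vectors F" "0 < c"
    and bal: "\<And>x. \<lbrakk>x \<in> F; 0 < p x\<rbrakk> \<Longrightarrow> Zapp F \<rho> p x = c"
  shows "HZ \<alpha> F \<rho> p = - ln c"
proof -
  have nn: "\<And>x. x \<in> F \<Longrightarrow> 0 \<le> p x" and s1: "sum p F = 1"
    using assms(2) by (auto simp: prob_vectors_def)
  have "\<exists>y\<in>F. p y \<noteq> 0" using s1 by (metis sum.neutral zero_neq_one)
  then obtain y where y: "y \<in> F" "0 < p y" using nn by force
  have avg: "(\<Sum>x\<in>F. p x * g (Zapp F \<rho> p x)) = g c" for g :: "real \<Rightarrow> real"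
  proof -
    have "(\<Sum>x\<in>F. p x * g (Zapp F \<rho> p x)) = (\<Sum>x\<in>F. p x * g c)"
    proof (rule sum.cong[OF refl])
      fix x assume "x \<in> F"
      then show "p x * g (Zapp F \<rho> p x) = p x * g c"
        using bal[of x] nn[of x] by (cases "p x = 0") auto
    qed
    then show ?thesis by (simp add: sum_distrib_right[symmetric] s1)
  qed
  consider "\<alpha> = \<infinity>" | "\<alpha> = 1" | "\<alpha> \<noteq> \<infinity>" "\<alpha> \<noteq> 1" by blast
  then show ?thesis
  proof cases
    case 1
    have "Zapp F \<rho> p ` {x\<in>F. 0 < p x} = {c}" using bal y by (auto simp: image_iff)
    then show ?thesis using 1 by (simp add: HZ_def)
  next
    case 2
    then show ?thesis using avg[of ln] by (simp add: HZ_def)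
  next
    case 3
    have "enn2real \<alpha> \<noteq> 1"
      using 3 by (metis ennreal_1 ennreal_enn2real infinity_ennreal_def less_top)
    then show ?thesis
      using 3 avg[of "\<lambda>v. v powr (enn2real \<alpha> - 1)"] assms(3)
      by (simp add: HZ_def ln_powr field_simps)
  qed
qed

text \<open>Contains the Leinster--Meckes theorem: the maximum of order \<open>0\<close> is the complexity of every
  order.\<close>

lemma complexity_balanced:
  assumes F: "finite F" "F \<noteq> {}"
    and sym: "\<And>x y. \<lbrakk>x \<in> F; y \<in> F\<rbrakk> \<Longrightarrow> \<rho> x y = \<rho> y x"
  obtains p where "p \<in> prob_vectors F"
    "\<And>x. \<lbrakk>x \<in> F; 0 < p x\<rbrakk> \<Longrightarrow> Zapp F \<rho> p x = exp (- complexity \<alpha> F \<rho>)"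
    "\<And>q. q \<in> prob_vectors F \<Longrightarrow> (\<Sum>x\<in>F. q x / Zapp F \<rho> q x) \<le> exp (complexity \<alpha> F \<rho>)"
proof -
  let ?f = "\<lambda>p. \<Sum>x\<in>F. p x / Zapp F \<rho> p x"
  obtain p where p: "p \<in> prob_vectors F" and opt: "\<And>q. q \<in> prob_vectors F \<Longrightarrow> ?f q \<le> ?f p"
    using order0_maximiser_exists[OF F] by blast
  have bal: "Zapp F \<rho> p x = 1 / ?f p" if "x \<in> F" "0 < p x" for x
    using order0_maximiser_balanced[OF F(1) sym p opt that] by blast
  have f_pos: "0 < ?f q" if q: "q \<in> prob_vectors F" for q
  proof -
    have nn: "\<And>x. x \<in> F \<Longrightarrow> 0 \<le> q x" and "sum q F = 1"
      using q by (auto simp: prob_vectors_def)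
    then have "\<exists>x\<in>F. q x \<noteq> 0" by (metis sum.neutral zero_neq_one)
    then obtain x where "x \<in> F" "0 < q x" using nn by force
    then show ?thesis
      using F(1) Zapp_pos[OF F(1) q] nn by (intro sum_pos2[of F x]) (auto simp: less_imp_le)
  qed
  have H: "HZ \<alpha> F \<rho> p = ln (?f p)"
    using HZ_balanced[OF F(1) p _ bal, of \<alpha>] f_pos[OF p] by (simp add: ln_div)
  \<comment> \<open>Order \<alpha> at any \<open>q\<close> is at most order 0 at \<open>q\<close>,
    hence at most order 0 at \<open>p\<close>, which equals order \<alpha> at \<open>p\<close> by
    balance.\<close>
  have "complexity \<alpha> F \<rho> = ln (?f p)"
    unfolding complexity_def
  proof (rule cSup_eq_maximum)
    show "ln (?f p) \<in> HZ \<alpha> F \<rho> ` prob_vectors F" using H p by force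
    show "h \<le> ln (?f p)" if h: "h \<in> HZ \<alpha> F \<rho> ` prob_vectors F" for h
    proof -
      obtain q where q: "q \<in> prob_vectors F" "h = HZ \<alpha> F \<rho> q" using h by blast
      have "ln (?f q) \<le> ln (?f p)" using f_pos q(1) p opt by (intro ln_mono) auto
      then show ?thesis using HZ_le_order0[OF F(1) q(1), of \<alpha> \<rho>] q(2) by simp
    qed
  qed
  then have "exp (complexity \<alpha> F \<rho>) = ?f p" using f_pos[OF p] by simp
  with bal opt p that[of p] show ?thesis by (simp add: exp_minus divide_inverse)
qed

section \<open>Complexity as a maximal mass\<close>

text \<open>Pointwise \<open>w \<le> w / Zw\<close>, and the sum of the right side is unchanged by
  normalising \<open>w\<close>, so the order 0 maximum bounds it. With
  \<open>exp_complexity_weight\<close>, exp C is the largest mass of a nonnegative \<open>w\<close>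
  with \<open>Zw \<le> 1\<close> on its support.\<close>

lemma sum_le_exp_complexity:
  assumes F: "finite F" "F \<noteq> {}"
    and sym: "\<And>x y. \<lbrakk>x \<in> F; y \<in> F\<rbrakk> \<Longrightarrow> \<rho> x y = \<rho> y x"
    and w: "\<And>x. x \<in> F \<Longrightarrow> 0 \<le> w x"
    and le: "\<And>x. \<lbrakk>x \<in> F; 0 < w x\<rbrakk> \<Longrightarrow> Zapp F \<rho> w x \<le> 1"
  shows "sum w F \<le> exp (complexity \<alpha> F \<rho>)"
proof (cases "sum w F = 0")
  case False
  then have pos: "0 < sum w F" using sum_nonneg[of F w] w by force
  have "w x \<le> w x / Zapp F \<rho> w x" if "x \<in> F" for x
  proof (cases "w x = 0")
    case False
    then have "0 < w x" using w[OF that] by simp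
    have "0 < Zmat \<rho> x x * w x" using \<open>0 < w x\<close> by (simp add: Zmat_def)
    also have "\<dots> \<le> Zapp F \<rho> w x"
      unfolding Zapp_def using F(1) that w by (intro member_le_sum) (auto simp: Zmat_def)
    finally show ?thesis
      using le[OF that \<open>0 < w x\<close>] \<open>0 < w x\<close> by (simp add: le_divide_eq mult_left_le)
  qed simp
  then have "sum w F \<le> (\<Sum>x\<in>F. w x / Zapp F \<rho> w x)" by (rule sum_mono)
  also have "\<dots> \<le> exp (complexity \<alpha> F \<rho>)"
  proof -
    have bound: "\<And>q. q \<in> prob_vectors F \<Longrightarrow>
        (\<Sum>x\<in>F. q x / Zapp F \<rho> q x) \<le> exp (complexity \<alpha> F \<rho>)"
      by (rule complexity_balanced[OF F sym, where \<alpha> = \<alpha>]) blast+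
    from bound[OF normalise_prob_vectors[OF w pos]] show ?thesis
      using order0_scale[where c = "inverse (sum w F)" and F = F and p = w and \<rho> = \<rho>] pos by simp
  qed
  finally show ?thesis .
qed (metis exp_ge_zero)

text \<open>Multiplying the balanced maximiser by exp C turns the constant exp(-C) into 1 and the
  mass 1 into exp C.\<close>

lemma exp_complexity_weight:
  assumes F: "finite F" "F \<noteq> {}"
    and sym: "\<And>x y. \<lbrakk>x \<in> F; y \<in> F\<rbrakk> \<Longrightarrow> \<rho> x y = \<rho> y x"
  obtains w where "\<And>x. x \<in> F \<Longrightarrow> 0 \<le> w x"
    "\<And>x. \<lbrakk>x \<in> F; 0 < w x\<rbrakk> \<Longrightarrow> Zapp F \<rho> w x = 1"
    "sum w F = exp (complexity \<alpha> F \<rho>)"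
proof -
  let ?e = "exp (complexity \<alpha> F \<rho>)"
  obtain p where p: "p \<in> prob_vectors F"
    and bal: "\<And>x. \<lbrakk>x \<in> F; 0 < p x\<rbrakk> \<Longrightarrow> Zapp F \<rho> p x = exp (- complexity \<alpha> F \<rho>)"
    by (rule complexity_balanced[OF F sym, where \<alpha> = \<alpha>]) blast+
  have scale: "Zapp F \<rho> (\<lambda>y. ?e * p y) x = ?e * Zapp F \<rho> p x" for x
    by (simp add: Zapp_def sum_distrib_left mult.left_commute)
  show ?thesis
  proof
    show "0 \<le> ?e * p x" if "x \<in> F" for x using p that by (simp add: prob_vectors_def)
    show "Zapp F \<rho> (\<lambda>y. ?e * p y) x = 1" if "x \<in> F" "0 < ?e * p x" for x
      using bal[of x] that by (simp add: scale zero_less_mult_iff exp_minus)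
    show "(\<Sum>x\<in>F. ?e * p x) = ?e"
      using p by (simp add: sum_distrib_left[symmetric] prob_vectors_def)
  qed
qed

section \<open>Double counting with a fractional partition\<close>

text \<open>Each \<open>x\<close> lies in some \<open>A i\<close>, and the sets \<open>s\<close>
  containing this \<open>i\<close> already have total \<beta>-weight 1. Hence \<open>w x\<close> is
  counted with coefficient at least 1 once the sums are exchanged.\<close>

lemma sum_le_fractional_sum:
  assumes \<beta>: "fractional_partition n \<beta>" and F: "finite F"
    and cov: "F \<subseteq> (\<Union>i\<in>{1..n}. A i)" and w: "\<And>x. x \<in> F \<Longrightarrow> 0 \<le> w x"
  shows "sum w F \<le> (\<Sum>s\<in>Pow {1..n}. \<beta> s * sum w (F \<inter> (\<Union>i\<in>s. A i)))"
proof -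
  have \<beta>_nn: "\<And>s. s \<in> Pow {1..n} \<Longrightarrow> 0 \<le> \<beta> s"
    and \<beta>_sum: "\<And>i. i \<in> {1..n} \<Longrightarrow> (\<Sum>s\<in>{s\<in>Pow {1..n}. i \<in> s}. \<beta> s) = 1"
    using \<beta> by (auto simp: fractional_partition_def)
  have "1 \<le> (\<Sum>s\<in>Pow {1..n}. \<beta> s * of_bool (x \<in> (\<Union>i\<in>s. A i)))" if x: "x \<in> F" for x
  proof -
    obtain i where i: "i \<in> {1..n}" "x \<in> A i" using cov x by blast
    have "1 = (\<Sum>s\<in>{s\<in>Pow {1..n}. i \<in> s}. \<beta> s * of_bool (x \<in> (\<Union>i\<in>s. A i)))"
      unfolding \<beta>_sum[OF i(1), symmetric] using i by (intro sum.cong) auto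
    also have "\<dots> \<le> (\<Sum>s\<in>Pow {1..n}. \<beta> s * of_bool (x \<in> (\<Union>i\<in>s. A i)))"
      using \<beta>_nn by (intro sum_mono2) auto
    finally show ?thesis .
  qed
  then have "w x * 1 \<le> w x * (\<Sum>s\<in>Pow {1..n}. \<beta> s * of_bool (x \<in> (\<Union>i\<in>s. A i)))" if "x \<in> F" for x
    using that w by (intro mult_left_mono) auto
  then have "sum w F \<le> (\<Sum>x\<in>F. w x * (\<Sum>s\<in>Pow {1..n}. \<beta> s * of_bool (x \<in> (\<Union>i\<in>s. A i))))"
    by (intro sum_mono) simp
  also have "\<dots> = (\<Sum>s\<in>Pow {1..n}. \<Sum>x\<in>F. \<beta> s * (w x * of_bool (x \<in> (\<Union>i\<in>s. A i))))"
    unfolding sum_distrib_left mult.left_commute[of "w _"] by (rule sum.swap)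
  also have "\<dots> = (\<Sum>s\<in>Pow {1..n}. \<beta> s * sum w (F \<inter> (\<Union>i\<in>s. A i)))"
  proof (rule sum.cong[OF refl])
    fix s
    have "(\<Sum>x\<in>F. w x * of_bool (x \<in> (\<Union>i\<in>s. A i))) = sum w (F \<inter> (\<Union>i\<in>s. A i))"
      using F by (intro sum.mono_neutral_cong_right) auto
    then show "(\<Sum>x\<in>F. \<beta> s * (w x * of_bool (x \<in> (\<Union>i\<in>s. A i))))
        = \<beta> s * sum w (F \<inter> (\<Union>i\<in>s. A i))"
      by (simp only: sum_distrib_left[symmetric])
  qed
  finally show ?thesis .
qed

section \<open>From finite sets to compact sets\<close>

context Metric_space
begin

lemma C_fin_le_C_cpt:
  assumes "compactin mtopology K" "0 < t" "F \<subseteq> K" "finite F"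
  shows "C_fin \<alpha> d t F \<le> C_cpt \<alpha> d t K"
  unfolding C_cpt_def using assms by (intro cSUP_upper bdd_above_C_fin) auto

lemma exp_C_fin_fractional:
  assumes \<beta>: "fractional_partition n \<beta>" and n: "1 \<le> n"
    and F: "finite F" "F \<subseteq> M" "F \<subseteq> (\<Union>i\<in>{1..n}. A i)"
  shows "exp (C_fin \<alpha> d t F) \<le> (\<Sum>s\<in>Pow {1..n}. \<beta> s * exp (C_fin \<alpha> d t (F \<inter> (\<Union>i\<in>s. A i))))"
proof -
  let ?\<rho> = "\<lambda>x y. t * d x y" and ?G = "\<lambda>s. F \<inter> (\<Union>i\<in>s. A i)"
  have \<beta>_nn: "\<And>s. s \<in> Pow {1..n} \<Longrightarrow> 0 \<le> \<beta> s"
    using \<beta> by (auto simp: fractional_partition_def)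
  have sym: "?\<rho> x y = ?\<rho> y x" for x y by (simp add: commute)
  show ?thesis
  proof (cases "F = {}")
    case True
    \<comment> \<open>Here every exponential is exp 0 = 1, so the total \<beta>-weight must be at
      least 1; the sets containing 1 already supply it, as \<open>n \<ge> 1\<close>.\<close>
    have "1 = (\<Sum>s\<in>{s\<in>Pow {1..n}. 1 \<in> s}. \<beta> s)"
      using \<beta> n by (simp add: fractional_partition_def)
    also have "\<dots> \<le> (\<Sum>s\<in>Pow {1..n}. \<beta> s)" using \<beta>_nn by (intro sum_mono2) auto
    finally show ?thesis using True by (simp add: C_fin_def)
  next
    case False
    obtain w where w: "\<And>x. x \<in> F \<Longrightarrow> 0 \<le> w x"
        "\<And>x. \<lbrakk>x \<in> F; 0 < w x\<rbrakk> \<Longrightarrow> Zapp F ?\<rho> w x = 1"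
        "sum w F = exp (complexity \<alpha> F ?\<rho>)"
      by (rule exp_complexity_weight[where \<rho> = "?\<rho>" and \<alpha> = \<alpha>, OF F(1) False sym]) blast+
    have part: "sum w (?G s) \<le> exp (C_fin \<alpha> d t (?G s))" for s
    proof (cases "?G s = {}")
      case True
      \<comment> \<open>An empty piece has mass 0, while the convention C = 0 makes its bound
        1.\<close>
      then show ?thesis by (simp add: C_fin_def)
    next
      case ne: False
      have "Zapp (?G s) ?\<rho> w x \<le> 1" if "x \<in> ?G s" "0 < w x" for x
      proof -
        have "Zapp (?G s) ?\<rho> w x \<le> Zapp F ?\<rho> w x"
          unfolding Zapp_def using F(1) w(1) by (intro sum_mono2) (auto simp: Zmat_def)
        then show ?thesis using w(2)[of x] that by simp
      qed
      then show ?thesis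
        using sum_le_exp_complexity[where \<rho> = "?\<rho>" and w = w and \<alpha> = \<alpha>, OF _ ne sym] F(1) w(1) ne by (simp add: C_fin_def)
    qed
    have "exp (C_fin \<alpha> d t F) = sum w F" using False w(3) by (simp add: C_fin_def)
    also have "\<dots> \<le> (\<Sum>s\<in>Pow {1..n}. \<beta> s * sum w (?G s))"
      by (rule sum_le_fractional_sum[OF \<beta> F(1,3) w(1)])
    also have "\<dots> \<le> (\<Sum>s\<in>Pow {1..n}. \<beta> s * exp (C_fin \<alpha> d t (?G s)))"
      using \<beta>_nn part by (intro sum_mono mult_left_mono) auto
    finally show ?thesis .
  qed
qed

text \<open>A finite subset \<open>F\<close> of the union meets each partial union in a finite
  subset of it, so the finite inequality bounds every \<open>F\<close> by the same right side; then
  the supremum over \<open>F\<close> is taken.\<close>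

lemma exp_C_cpt_fractional:
  assumes \<beta>: "fractional_partition n \<beta>" and n: "1 \<le> n"
    and A: "\<And>i. i \<in> {1..n} \<Longrightarrow> compactin mtopology (A i)" and t: "0 < t"
  shows "exp (C_cpt \<alpha> d t (\<Union>i\<in>{1..n}. A i))
    \<le> (\<Sum>s\<in>Pow {1..n}. \<beta> s * exp (C_cpt \<alpha> d t (\<Union>i\<in>s. A i)))" (is "_ \<le> ?R")
proof -
  let ?U = "\<lambda>s. \<Union>i\<in>s. A i"
  have comp: "compactin mtopology (?U s)" if "s \<subseteq> {1..n}" for s
    using that A finite_subset[OF that] by (intro compactin_Union) auto
  have UM: "?U {1..n} \<subseteq> M" using compactin_subset_topspace[OF comp[OF order_refl]] by simp
  have le_R: "exp (C_fin \<alpha> d t F) \<le> ?R" if F: "F \<subseteq> ?U {1..n}" "finite F" for F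
  proof -
    have "exp (C_fin \<alpha> d t F) \<le> (\<Sum>s\<in>Pow {1..n}. \<beta> s * exp (C_fin \<alpha> d t (F \<inter> ?U s)))"
      using F UM by (intro exp_C_fin_fractional[OF \<beta> n]) auto
    also have "\<dots> \<le> ?R"
      using \<beta> comp t F(2)
      by (intro sum_mono mult_left_mono) (auto simp: fractional_partition_def intro!: C_fin_le_C_cpt)
    finally show ?thesis .
  qed
  \<comment> \<open>The empty set gives \<open>1 \<le> ?R\<close>, so logarithms may be taken and
    the supremum formed in C itself.\<close>
  have R: "0 < ?R" using le_R[of "{}"] by (simp add: C_fin_def)
  have "C_cpt \<alpha> d t (?U {1..n}) \<le> ln ?R"
    unfolding C_cpt_def[of _ _ _ "?U {1..n}"]
  proof (rule cSUP_least)
    show "C_fin \<alpha> d t F \<le> ln ?R" if "F \<in> {F. F \<subseteq> ?U {1..n} \<and> finite F}" for F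
      using le_R[of F] that R by (simp add: ln_ge_iff)
  qed auto
  then show ?thesis using R by (simp add: ln_ge_iff)
qed

end

theorem theorem1p12:
  fixes X :: "'a set" and d :: "'a \<Rightarrow> 'a \<Rightarrow> real"
    and n :: nat and A :: "nat \<Rightarrow> 'a set" and t :: real and \<alpha> :: ennreal
  assumes "Metric_space X d"
    and "n \<ge> 1"
    and "\<And>i. i \<in> {1..n} \<Longrightarrow> compactin (Metric_space.mtopology X d) (A i)"
    and "t > 0"
  shows "(\<forall>\<beta>. fractional_partition n \<beta> \<longrightarrow>
            exp (C_cpt \<alpha> d t (\<Union>i\<in>{1..n}. A i))
              \<le> (\<Sum>s\<in>Pow {1..n}. \<beta> s * exp (C_cpt \<alpha> d t (\<Union>i\<in>s. A i))))
       \<and> fractionally_subadditive n (\<lambda>s. 1 + kappa \<alpha> d t (\<Union>i\<in>s. A i))"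
  \<comment> \<open>Since 1 + \<open>kappa\<close> is exp C, both conjuncts are the same
    inequality.\<close>
  using Metric_space.exp_C_cpt_fractional[OF assms(1) _ assms(2), of _ A, OF _ assms(3,4)]
  unfolding fractionally_subadditive_def kappa_def add_diff_cancel_left' add.commute[of 1] diff_add_cancel
  by blast

end
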